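(* Let $S=(1,2,2,2,\ldots)$, i.e. $a_1=1$ and $a_i=2$ for all $i\geq 2$, and let $n\geq 3$. Then $$\chi_S''(C_n)=\begin{cases}5, & n\notin\{4,7\},\\ 6, & n=7,\\ 7, & n=4.\end{cases}$$
   Context: $C_n$ is the cycle on $n$ vertices. For vertices $u,v$ of a graph $G$, $d(u,v)$ is the usual shortest-path distance. For a vertex $u$ and an edge $ab$, $d(u,ab)=d(ab,u)=\min\{d(u,a),d(u,b)\}+1$. For two distinct edges $ab,cd$, $d(ab,cd)=\min\{d(a,c),d(a,d),d(b,c),d(b,d)\}+1$. For a non-decreasing infinite sequence $S=(a_1,a_2,\ldots)$ of positive integers, an $S$-packing total coloring of $G$ using $k$ colors is a map $c:V(G)\cup E(G)\to\{1,\ldots,k\}$ such that any two distinct elements $A,B\in V(G)\cup E(G)$ with $c(A)=c(B)=i$ satisfy $d(A,B)>a_i$. The $S$-packing total chromatic number $\chi_S''(G)$ is the smallest $k$ for which one exists. *)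

theory Defs
  imports Complex_Main "HOL-Library.Extended_Nat" "HOL-Library.FuncSet"
begin

text \<open>A simple graph is given by its vertices and its edges, an edge being the two-element set of
  its ends.\<close>

record 'a ugraph =
  verts :: "'a set"
  edges :: "'a set set"

definition walk :: "'a ugraph \<Rightarrow> 'a list \<Rightarrow> bool" where
  "walk G xs \<longleftrightarrow> xs \<noteq> [] \<and> set xs \<subseteq> verts G \<and>
     (\<forall>i. Suc i < length xs \<longrightarrow> {xs ! i, xs ! Suc i} \<in> edges G)"

text \<open>The distance is \<open>\<infinity>\<close> when no walk joins the two vertices. In \<^typ>\<open>enat\<close> every
  nonempty set has a least element, so the other infima here and below are minima.\<close>

definition vdist :: "'a ugraph \<Rightarrow> 'a \<Rightarrow> 'a \<Rightarrow> enat" where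
  "vdist G u v =
     Inf {enat (length xs - 1) | xs. walk G xs \<and> hd xs = u \<and> last xs = v}"

text \<open>Elements of the disjoint union of vertices (\<^const>\<open>Inl\<close>) and edges (\<^const>\<open>Inr\<close>). The last
  clause is the distance of two \<^emph>\<open>distinct\<close> edges; it is only used for those.\<close>

fun elem_dist :: "'a ugraph \<Rightarrow> 'a + 'a set \<Rightarrow> 'a + 'a set \<Rightarrow> enat" where
  "elem_dist G (Inl u) (Inl v) = vdist G u v"
| "elem_dist G (Inl u) (Inr e) = (INF a\<in>e. vdist G u a) + 1"
| "elem_dist G (Inr e) (Inl u) = (INF a\<in>e. vdist G u a) + 1"
| "elem_dist G (Inr e) (Inr f) = (INF a\<in>e. INF b\<in>f. vdist G a b) + 1"

text \<open>Sequences are indexed from 1; the value \<open>S 0\<close> is never used.\<close>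

definition packing_total_coloring ::
    "(nat \<Rightarrow> nat) \<Rightarrow> 'a ugraph \<Rightarrow> nat \<Rightarrow> ('a + 'a set \<Rightarrow> nat) \<Rightarrow> bool" where
  "packing_total_coloring S G k c \<longleftrightarrow>
     c \<in> (verts G <+> edges G) \<rightarrow> {1..k} \<and>
     (\<forall>A \<in> verts G <+> edges G. \<forall>B \<in> verts G <+> edges G.
        A \<noteq> B \<and> c A = c B \<longrightarrow> elem_dist G A B > enat (S (c A)))"

text \<open>A finite graph always has such a coloring (give all elements different colors), so the
  minimum exists.\<close>

definition packing_total_chromatic_number :: "(nat \<Rightarrow> nat) \<Rightarrow> 'a ugraph \<Rightarrow> nat" where
  "packing_total_chromatic_number S G = (LEAST k. \<exists>c. packing_total_coloring S G k c)"

text \<open>The cycle on \<open>n\<close> vertices; a simple graph for \<open>n \<ge> 3\<close>.\<close>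

definition cycle_graph :: "nat \<Rightarrow> nat ugraph" where
  "cycle_graph n = \<lparr>verts = {0..<n}, edges = {{i, Suc i mod n} | i. i < n}\<rparr>"

end

theory Submission
  imports Defs
begin

text \<open>
  List the elements of \<open>C\<^sub>n\<close> in the order in which they occur along the cycle: vertex \<open>0\<close>, edge
  \<open>01\<close>, vertex \<open>1\<close>, edge \<open>12\<close>, and so on. This identifies them with the residues modulo
  \<open>N = 2 n\<close>, and the distance of two distinct elements is half the cyclic distance of their residues,
  rounded up (\<open>elem_dist_cycle_graph\<close>). A coloring with \<open>k\<close> colors is therefore a coloring of the
  residues modulo \<open>N\<close> in which residues of equal color are at cyclic distance at least 3 when the color
  is 1 and at least 5 otherwise (\<open>ex_packing_total_coloring_iff\<close>).

  For the lower bounds, a set of residues with mutual cyclic distances at least \<open>g\<close> has at most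
  \<open>N div g\<close> members (\<open>card_separated_le\<close>), whence \<open>N \<le> N div 3 + (k - 1) * (N div 5)\<close>. As
  \<open>1/3 + 3/5 < 1\<close>, this always forces \<open>k \<ge> 5\<close>. The two exceptional cases are caused by the
  rounding: \<open>N = 8\<close> gives \<open>8 \<le> 2 + (k - 1)\<close>, and \<open>N = 14\<close> gives \<open>14 \<le> 4 + 2 * (k - 1)\<close>.

  For the upper bounds, the periodic word \<open>12345\<close> is a good pattern, and it stays one when an
  additional 1 is inserted between 3 and 4 in any of its periods. So blocks \<open>12345\<close> and
  \<open>123145\<close> may be strung together around the cycle in any order (\<open>well_spaced_blocks\<close>), which
  colors \<open>C\<^sub>n\<close> with five colors whenever \<open>2 n = 6 a + 10 b\<close>, that is, \<open>n = 3 a + 5 b\<close>. Among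
  the integers from 3 on only 4 and 7 are not of this form; for these, explicit words attain the
  counting bound.
\<close>

section \<open>Distances in a cycle\<close>

text \<open>On natural numbers one of the two truncated differences is 0, so their sum is \<open>\<bar>p - q\<bar>\<close>.\<close>

definition cyc_dist :: "nat \<Rightarrow> nat \<Rightarrow> nat \<Rightarrow> nat" where
  "cyc_dist N p q = min ((p - q) + (q - p)) (N - ((p - q) + (q - p)))"

lemma cyc_dist_commute: "cyc_dist N p q = cyc_dist N q p"
  by (simp add: cyc_dist_def add.commute)

lemma cyc_dist_step:
  assumes "v < n" "w < n" "{u, v} = {i, Suc i mod n}" "i < n"
  shows "cyc_dist n u w \<le> Suc (cyc_dist n v w)"
proof (cases "Suc i < n")
  case True
  then have "u = i \<and> v = Suc i \<or> v = i \<and> u = Suc i"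
    using assms(3) by (auto simp: doubleton_eq_iff)
  then show ?thesis
    using assms(1,2) True by (cases "w \<le> i") (auto simp: cyc_dist_def min_def)
next
  case False
  then have "Suc i = n" using assms(4) by simp
  then have "u = i \<and> v = 0 \<or> v = i \<and> u = 0"
    using assms(3) by (auto simp: doubleton_eq_iff)
  then show ?thesis
    using assms(1,2) \<open>Suc i = n\<close> by (auto simp: cyc_dist_def min_def)
qed

lemma walk_Cons_Cons:
  "walk G (x # y # ys) \<longleftrightarrow> x \<in> verts G \<and> {x, y} \<in> edges G \<and> walk G (y # ys)"
proof -
  have "(\<forall>i. Suc i < length (x # y # ys) \<longrightarrow> {(x # y # ys) ! i, (x # y # ys) ! Suc i} \<in> edges G)
     \<longleftrightarrow> {x, y} \<in> edges G \<and>
       (\<forall>i. Suc i < length (y # ys) \<longrightarrow> {(y # ys) ! i, (y # ys) ! Suc i} \<in> edges G)"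
    by (simp add: All_less_Suc2)
  then show ?thesis
    unfolding walk_def by auto
qed

text \<open>Each edge of a walk changes the cyclic distance to a fixed vertex by at most 1; hence no walk
  can be a shortcut, and it remains to walk around the cycle along the shorter arc.\<close>

lemma cyc_dist_le_walk:
  assumes "walk (cycle_graph n) xs"
  shows "cyc_dist n (hd xs) (last xs) \<le> length xs - 1"
  using assms
proof (induction xs rule: induct_list012)
  case 1
  then show ?case by (simp add: walk_def)
next
  case (2 x)
  then show ?case by (simp add: cyc_dist_def)
next
  case (3 x y zs)
  from 3(3) have w: "walk (cycle_graph n) (y # zs)" and e: "{x, y} \<in> edges (cycle_graph n)"
    by (simp_all add: walk_Cons_Cons)
  from w have "set (y # zs) \<subseteq> {0..<n}"
    by (simp add: walk_def cycle_graph_def)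
  then have "y < n" "last (y # zs) < n"
    using last_in_set[of "y # zs"] by auto
  moreover from e obtain i where "i < n" "{x, y} = {i, Suc i mod n}"
    by (auto simp: cycle_graph_def)
  ultimately have "cyc_dist n x (last (y # zs)) \<le> Suc (cyc_dist n y (last (y # zs)))"
    by (intro cyc_dist_step)
  then show ?case using 3(2)[OF w] by simp
qed

lemma walk_rev:
  assumes "walk G xs"
  shows "walk G (rev xs)"
proof -
  have "{rev xs ! i, rev xs ! Suc i} \<in> edges G" if "Suc i < length xs" for i
  proof -
    let ?j = "length xs - Suc (Suc i)"
    have "{xs ! ?j, xs ! Suc ?j} \<in> edges G"
      using assms that by (simp add: walk_def)
    moreover have "Suc ?j = length xs - Suc i" using that by simp
    ultimately show ?thesis
      using that by (simp add: rev_nth insert_commute)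
  qed
  then show ?thesis using assms by (simp add: walk_def)
qed

lemma vdist_le_walk: "walk G xs \<Longrightarrow> vdist G (hd xs) (last xs) \<le> enat (length xs - 1)"
  unfolding vdist_def by (rule Inf_lower) blast

lemma vdist_commute_le: "vdist G u v \<le> vdist G v u"
  unfolding vdist_def[of G v u]
proof (rule Inf_greatest)
  fix x assume "x \<in> {enat (length xs - 1) | xs. walk G xs \<and> hd xs = v \<and> last xs = u}"
  then obtain xs where "x = enat (length xs - 1)" "walk G xs" "hd xs = v" "last xs = u"
    by blast
  then show "vdist G u v \<le> x"
    using vdist_le_walk[OF walk_rev[of G xs]]
    by (simp add: walk_def hd_rev last_rev)
qed

lemma vdist_commute: "vdist G u v = vdist G v u"
  by (intro antisym vdist_commute_le)

lemma vdist_cycle_graph_forward: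
  assumes "u < n"
  shows "vdist (cycle_graph n) u ((u + d) mod n) \<le> enat d"
proof -
  let ?xs = "map (\<lambda>i. (u + i) mod n) [0..<Suc d]"
  have "{?xs ! i, ?xs ! Suc i} \<in> edges (cycle_graph n)" if "Suc i < length ?xs" for i
  proof -
    have "?xs ! i = (u + i) mod n" "?xs ! Suc i = Suc ((u + i) mod n) mod n"
      using that nth_map_upt[of i "Suc d" 0 "\<lambda>i. (u + i) mod n"]
        nth_map_upt[of "Suc i" "Suc d" 0 "\<lambda>i. (u + i) mod n"]
      by (auto simp: mod_Suc_eq simp del: upt_Suc)
    then show ?thesis
      using assms by (auto simp: cycle_graph_def intro!: exI[of _ "(u + i) mod n"])
  qed
  moreover have "set ?xs \<subseteq> verts (cycle_graph n)"
    using assms by (auto simp: cycle_graph_def)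
  ultimately have "walk (cycle_graph n) ?xs"
    by (simp add: walk_def)
  then have "vdist (cycle_graph n) (hd ?xs) (last ?xs) \<le> enat (length ?xs - 1)"
    by (rule vdist_le_walk)
  moreover have "hd ?xs = u" "last ?xs = (u + d) mod n"
    using assms by (simp_all add: hd_map last_map del: upt_Suc)
  ultimately show ?thesis by simp
qed

text \<open>Both arcs between \<open>u\<close> and \<open>v\<close> are walked in the increasing direction, one from \<open>u\<close> and the
  other from \<open>v\<close>.\<close>

lemma vdist_cycle_graph_le:
  assumes "u \<le> v" "v < n"
  shows "vdist (cycle_graph n) u v \<le> enat (cyc_dist n u v)"
proof -
  have "vdist (cycle_graph n) u v \<le> enat (v - u)"
    using vdist_cycle_graph_forward[of u n "v - u"] assms by simp
  moreover have "(v + (n - (v - u))) mod n = u"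
    using assms by (simp add: mod_if)
  then have "vdist (cycle_graph n) v u \<le> enat (n - (v - u))"
    using vdist_cycle_graph_forward[of v n "n - (v - u)"] assms by simp
  ultimately show ?thesis
    using assms by (simp add: cyc_dist_def vdist_commute[of _ v u] min_def)
qed

lemma vdist_cycle_graph:
  assumes "u < n" "v < n"
  shows "vdist (cycle_graph n) u v = enat (cyc_dist n u v)"
proof (rule antisym)
  show "vdist (cycle_graph n) u v \<le> enat (cyc_dist n u v)"
    using vdist_cycle_graph_le[of u v n] vdist_cycle_graph_le[of v u n] assms
    by (cases "u \<le> v") (simp_all add: vdist_commute[of _ u v] cyc_dist_commute[of _ u v])
  show "enat (cyc_dist n u v) \<le> vdist (cycle_graph n) u v"
    unfolding vdist_def
    by (rule Inf_greatest) (auto dest: cyc_dist_le_walk)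
qed

section \<open>The cyclic order of vertices and edges\<close>

definition cycle_edge :: "nat \<Rightarrow> nat \<Rightarrow> nat set" where
  "cycle_edge n i = {i, Suc i mod n}"

text \<open>The total order along the cycle: even positions are vertices, odd positions are the edges
  between the two neighboring vertices.\<close>

definition cycle_elem :: "nat \<Rightarrow> nat \<Rightarrow> nat + nat set" where
  "cycle_elem n p = (if even p then Inl (p div 2) else Inr (cycle_edge n (p div 2)))"

text \<open>For \<open>n = 2\<close> the edges \<open>{0, 1}\<close> and \<open>{1, 0}\<close> would coincide.\<close>

lemma inj_on_cycle_edge:
  assumes "n \<ge> 3"
  shows "inj_on (cycle_edge n) {0..<n}"
proof (rule inj_onI)
  fix i j assume "i \<in> {0..<n}" "j \<in> {0..<n}" "cycle_edge n i = cycle_edge n j"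
  then show "i = j"
    using assms by (auto simp: cycle_edge_def doubleton_eq_iff mod_Suc split: if_splits)
qed

lemma bij_betw_cycle_elem:
  assumes "n \<ge> 3"
  shows "bij_betw (cycle_elem n) {0..<2 * n} (verts (cycle_graph n) <+> edges (cycle_graph n))"
proof (rule bij_betw_imageI)
  show "inj_on (cycle_elem n) {0..<2 * n}"
  proof (rule inj_onI)
    fix p q assume *: "p \<in> {0..<2 * n}" "q \<in> {0..<2 * n}" "cycle_elem n p = cycle_elem n q"
    then have "p div 2 \<in> {0..<n}" "q div 2 \<in> {0..<n}" by auto
    then have "p div 2 = q div 2 \<and> even p = even q"
      using * inj_onD[OF inj_on_cycle_edge[OF assms], of "p div 2" "q div 2"]
      by (auto simp: cycle_elem_def split: if_splits)
    then show "p = q" by (metis even_two_times_div_two odd_two_times_div_two_succ)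
  qed
  show "cycle_elem n ` {0..<2 * n} = verts (cycle_graph n) <+> edges (cycle_graph n)"
  proof (intro equalityI subsetI)
    fix x assume "x \<in> cycle_elem n ` {0..<2 * n}"
    then show "x \<in> verts (cycle_graph n) <+> edges (cycle_graph n)"
      by (auto simp: cycle_elem_def cycle_edge_def cycle_graph_def split: if_splits)
  next
    fix x assume "x \<in> verts (cycle_graph n) <+> edges (cycle_graph n)"
    then consider i where "i < n" "x = Inl i" | i where "i < n" "x = Inr (cycle_edge n i)"
      by (auto simp: cycle_graph_def cycle_edge_def)
    then show "x \<in> cycle_elem n ` {0..<2 * n}"
    proof cases
      case 1
      then show ?thesis by (intro image_eqI[of _ _ "2 * i"]) (simp_all add: cycle_elem_def)
    next
      case 2
      then show ?thesis by (intro image_eqI[of _ _ "Suc (2 * i)"]) (simp_all add: cycle_elem_def)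
    qed
  qed
qed

lemma INF_cycle_edge:
  fixes f :: "nat \<Rightarrow> enat"
  shows "(INF a\<in>cycle_edge n i. f a) = min (f i) (f (Suc i mod n))"
  by (simp add: cycle_edge_def inf_min)

lemma Suc_mod_cases:
  assumes "i < n"
  obtains "Suc i < n" "Suc i mod n = Suc i" | "Suc i = n" "Suc i mod n = 0"
  using assms by (metis Suc_lessI mod_less mod_self)

text \<open>The end of edge \<open>j\<close> nearest to vertex \<open>i\<close> lies one position closer to \<open>i\<close> than the edge
  does; for two edges, the nearest ends lie two positions closer to each other. Positions count
  each step along the cycle twice. The two cases in the proofs separate the edge that closes the
  cycle from the others; writing \<open>j\<close> and \<open>n\<close> as sums removes the truncated subtractions.\<close>

lemma cyc_dist_vertex_edge:
  assumes "i < n" "j < n"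
  shows "Suc (cyc_dist (2 * n) (2 * i) (Suc (2 * j)))
    = 2 * Suc (min (cyc_dist n i j) (cyc_dist n i (Suc j mod n)))"
proof (cases "i \<le> j")
  case True
  then obtain d where d: "j = i + d" using le_Suc_ex by blast
  show ?thesis using \<open>j < n\<close>
  proof (cases rule: Suc_mod_cases)
    case 1
    then obtain e where "n = j + 2 + e" by (metis Suc_leI add_2_eq_Suc' le_Suc_ex)
    then show ?thesis unfolding 1(2) d cyc_dist_def by (auto simp: min_def)
  next
    case 2
    then have "n = Suc (i + d)" using d by simp
    then show ?thesis unfolding 2(2) d cyc_dist_def by (auto simp: min_def)
  qed
next
  case False
  then obtain d where d: "i = Suc (j + d)" using less_iff_Suc_add[of j i] by auto
  then have "Suc j < n" using assms by simp
  moreover obtain e where "n = Suc (i + e)" using assms less_iff_Suc_add by auto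
  ultimately show ?thesis unfolding d cyc_dist_def by (auto simp: min_def)
qed

lemma cyc_dist_edge_edge:
  assumes "i < j" "j < n"
  shows "cyc_dist (2 * n) (Suc (2 * i)) (Suc (2 * j))
    = 2 * Suc (min (min (cyc_dist n i j) (cyc_dist n i (Suc j mod n)))
                   (min (cyc_dist n (Suc i) j) (cyc_dist n (Suc i) (Suc j mod n))))"
proof -
  from assms obtain d where d: "j = Suc (i + d)" using less_iff_Suc_add by auto
  show ?thesis using \<open>j < n\<close>
  proof (cases rule: Suc_mod_cases)
    case 1
    then obtain e where "n = j + 2 + e" by (metis Suc_leI add_2_eq_Suc' le_Suc_ex)
    then show ?thesis unfolding 1(2) d cyc_dist_def by (auto simp: min_def)
  next
    case 2
    then have "n = Suc (Suc (i + d))" using d by simp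
    then show ?thesis unfolding 2(2) d cyc_dist_def by (auto simp: min_def)
  qed
qed

lemma elem_dist_commute: "elem_dist G A B = elem_dist G B A"
proof (cases A; cases B)
  fix u v assume "A = Inl u" "B = Inl v"
  then show ?thesis using vdist_commute[of G u v] by simp
next
  fix e f assume "A = Inr e" "B = Inr f"
  moreover have "(INF a\<in>e. INF b\<in>f. vdist G a b) = (INF b\<in>f. INF a\<in>e. vdist G a b)"
    by (rule INF_commute)
  moreover have "\<dots> = (INF b\<in>f. INF a\<in>e. vdist G b a)"
    by (intro INF_cong refl vdist_commute)
  ultimately show ?thesis by simp
qed simp_all

lemma elem_dist_cycle_graph:
  assumes "p < 2 * n" "q < 2 * n" "p \<noteq> q"
  shows "elem_dist (cycle_graph n) (cycle_elem n p) (cycle_elem n q)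
    = enat (Suc (cyc_dist (2 * n) p q) div 2)"
proof -
  have vertex_edge: "elem_dist (cycle_graph n) (cycle_elem n (2 * i)) (cycle_elem n (Suc (2 * j)))
      = enat (Suc (cyc_dist (2 * n) (2 * i) (Suc (2 * j))) div 2)" if "i < n" "j < n" for i j
    using that
    by (simp add: cycle_elem_def INF_cycle_edge vdist_cycle_graph one_enat_def
        cyc_dist_vertex_edge)
  have edge_edge: "elem_dist (cycle_graph n) (cycle_elem n (Suc (2 * i))) (cycle_elem n (Suc (2 * j)))
      = enat (Suc (cyc_dist (2 * n) (Suc (2 * i)) (Suc (2 * j))) div 2)" if "i < j" "j < n" for i j
    using that
    by (simp add: cycle_elem_def INF_cycle_edge vdist_cycle_graph one_enat_def
        cyc_dist_edge_edge)
  define i j where "i = p div 2" and "j = q div 2"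
  have "i < n" "j < n" using assms by (auto simp: i_def j_def)
  consider "p = 2 * i" "q = 2 * j" | "p = 2 * i" "q = Suc (2 * j)"
    | "p = Suc (2 * i)" "q = 2 * j" | "p = Suc (2 * i)" "q = Suc (2 * j)"
    unfolding i_def j_def by (metis even_two_times_div_two odd_two_times_div_two_succ Suc_eq_plus1)
  then show ?thesis
  proof cases
    case 1
    have "cyc_dist (2 * n) (2 * i) (2 * j) = 2 * cyc_dist n i j"
      by (cases "i \<le> j") (auto simp: cyc_dist_def min_def)
    then show ?thesis
      using 1 \<open>i < n\<close> \<open>j < n\<close> by (simp add: cycle_elem_def vdist_cycle_graph)
  next
    case 2
    then show ?thesis using vertex_edge \<open>i < n\<close> \<open>j < n\<close> by simp
  next
    case 3
    then show ?thesis using vertex_edge[of j i] \<open>i < n\<close> \<open>j < n\<close>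
      by (simp add: elem_dist_commute[of _ "cycle_elem n (Suc (2 * i))"]
          cyc_dist_commute[of _ "Suc (2 * i)"])
  next
    case 4
    then consider "i < j" | "j < i" using assms(3) by fastforce
    then show ?thesis
    proof cases
      case 1
      then show ?thesis using 4 edge_edge \<open>j < n\<close> by simp
    next
      case 2
      then show ?thesis using 4 edge_edge[of j i] \<open>i < n\<close>
        by (simp add: elem_dist_commute[of _ "cycle_elem n (Suc (2 * i))"]
            cyc_dist_commute[of _ "Suc (2 * i)"])
    qed
  qed
qed

section \<open>Colorings of the residues modulo twice the length\<close>

text \<open>Half of \<open>d\<close>, rounded up, exceeds 1 iff \<open>d \<ge> 3\<close>, and exceeds 2 iff \<open>d \<ge> 5\<close>.\<close>

definition gap :: "nat \<Rightarrow> nat" where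
  "gap i = (if i = 1 then 3 else 5)"

definition cyclic_coloring :: "nat \<Rightarrow> nat \<Rightarrow> (nat \<Rightarrow> nat) \<Rightarrow> bool" where
  "cyclic_coloring N k f \<longleftrightarrow> f \<in> {0..<N} \<rightarrow> {1..k} \<and>
     (\<forall>p<N. \<forall>q<N. p \<noteq> q \<and> f p = f q \<longrightarrow> gap (f p) \<le> cyc_dist N p q)"

lemma packing_total_coloring_iff_cyclic_coloring:
  assumes S: "S 1 = 1" "\<And>i. i \<ge> 2 \<Longrightarrow> S i = 2" and n: "n \<ge> 3"
  shows "packing_total_coloring S (cycle_graph n) k c
    \<longleftrightarrow> cyclic_coloring (2 * n) k (c \<circ> cycle_elem n)"
proof -
  let ?G = "cycle_graph n" and ?e = "cycle_elem n"
  have im: "verts ?G <+> edges ?G = ?e ` {0..<2 * n}"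
    by (rule bij_betw_imp_surj_on[OF bij_betw_cycle_elem[OF n], symmetric])
  have inj: "?e p = ?e q \<longleftrightarrow> p = q" if "p < 2 * n" "q < 2 * n" for p q
    using inj_on_eq_iff[OF bij_betw_imp_inj_on[OF bij_betw_cycle_elem[OF n]]] that by simp
  have far: "enat (S i) < elem_dist ?G (?e p) (?e q) \<longleftrightarrow> gap i \<le> cyc_dist (2 * n) p q"
    if "p < 2 * n" "q < 2 * n" "p \<noteq> q" "i \<ge> 1" for i p q
  proof -
    have "S i < Suc d div 2 \<longleftrightarrow> gap i \<le> d" for d
      using S that(4) by (cases "i = 1") (auto simp: gap_def)
    then show ?thesis using that by (simp add: elem_dist_cycle_graph)
  qed
  have pair: "(?e p \<noteq> ?e q \<and> c (?e p) = c (?e q) \<longrightarrow>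
        enat (S (c (?e p))) < elem_dist ?G (?e p) (?e q))
      \<longleftrightarrow> (p \<noteq> q \<and> c (?e p) = c (?e q) \<longrightarrow> gap (c (?e p)) \<le> cyc_dist (2 * n) p q)"
    if "c \<circ> ?e \<in> {0..<2 * n} \<rightarrow> {1..k}" "p \<in> {0..<2 * n}" "q \<in> {0..<2 * n}" for p q
  proof -
    have "c (?e p) \<ge> 1" using that by (simp add: Pi_iff)
    then show ?thesis using inj[of p q] far[of p q "c (?e p)"] that by auto
  qed
  have "c \<in> ?e ` {0..<2 * n} \<rightarrow> {1..k} \<longleftrightarrow> c \<circ> ?e \<in> {0..<2 * n} \<rightarrow> {1..k}"
    by (simp add: Pi_iff)
  then have "packing_total_coloring S ?G k c \<longleftrightarrow> c \<circ> ?e \<in> {0..<2 * n} \<rightarrow> {1..k} \<and>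
      (\<forall>p\<in>{0..<2 * n}. \<forall>q\<in>{0..<2 * n}. ?e p \<noteq> ?e q \<and> c (?e p) = c (?e q) \<longrightarrow>
        enat (S (c (?e p))) < elem_dist ?G (?e p) (?e q))"
    unfolding packing_total_coloring_def im by (simp only: ball_simps)
  also have "\<dots> \<longleftrightarrow> c \<circ> ?e \<in> {0..<2 * n} \<rightarrow> {1..k} \<and>
      (\<forall>p\<in>{0..<2 * n}. \<forall>q\<in>{0..<2 * n}. p \<noteq> q \<and> c (?e p) = c (?e q) \<longrightarrow>
        gap (c (?e p)) \<le> cyc_dist (2 * n) p q)"
    by (intro conj_cong ball_cong refl pair)
  also have "\<dots> \<longleftrightarrow> cyclic_coloring (2 * n) k (c \<circ> ?e)"
    unfolding cyclic_coloring_def by (simp add: Ball_def)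
  finally show ?thesis .
qed

lemma ex_packing_total_coloring_iff:
  assumes "S 1 = 1" "\<And>i. i \<ge> 2 \<Longrightarrow> S i = 2" "n \<ge> 3"
  shows "(\<exists>c. packing_total_coloring S (cycle_graph n) k c) \<longleftrightarrow> (\<exists>f. cyclic_coloring (2 * n) k f)"
proof
  assume "\<exists>c. packing_total_coloring S (cycle_graph n) k c"
  then show "\<exists>f. cyclic_coloring (2 * n) k f"
    using packing_total_coloring_iff_cyclic_coloring[of S n k, OF assms] by blast
next
  assume "\<exists>f. cyclic_coloring (2 * n) k f"
  then obtain f where f: "cyclic_coloring (2 * n) k f" ..
  let ?c = "f \<circ> the_inv_into {0..<2 * n} (cycle_elem n)"
  have "inj_on (cycle_elem n) {0..<2 * n}"
    by (rule bij_betw_imp_inj_on[OF bij_betw_cycle_elem[OF assms(3)]])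
  then have "(?c \<circ> cycle_elem n) p = f p" if "p < 2 * n" for p
    using that by (simp add: the_inv_into_f_f)
  then have "cyclic_coloring (2 * n) k (?c \<circ> cycle_elem n)"
    using f by (simp add: cyclic_coloring_def Pi_iff)
  then show "\<exists>c. packing_total_coloring S (cycle_graph n) k c"
    using packing_total_coloring_iff_cyclic_coloring[of S n k, OF assms] by blast
qed

section \<open>Lower bounds by counting\<close>

text \<open>The cyclic intervals of length \<open>g\<close> that start at the members of \<open>A\<close> are disjoint. The
  condition \<open>g \<le> N\<close> keeps a single one of them from overlapping itself.\<close>

lemma card_separated_le:
  assumes A: "A \<subseteq> {0..<N}" and g: "0 < g" "g \<le> N"
    and sep: "\<And>p q. p \<in> A \<Longrightarrow> q \<in> A \<Longrightarrow> p \<noteq> q \<Longrightarrow> g \<le> cyc_dist N p q"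
  shows "card A \<le> N div g"
proof -
  let ?h = "\<lambda>(p, j). (p + j) mod N"
  have "inj_on ?h (A \<times> {0..<g})"
  proof (rule inj_onI, clarsimp)
    fix p i q j
    assume pq: "p \<in> A" "q \<in> A" and ij: "i < g" "j < g" and eq: "(p + i) mod N = (q + j) mod N"
    have "p < N" "q < N" using A pq by auto
    \<comment> \<open>Both sums are below \<open>2 N\<close>, so congruent ones differ by at most one turn.\<close>
    then have "p + i = q + j \<or> p + i = q + j + N \<or> p + i + N = q + j"
      using eq ij g by (auto simp: mod_if split: if_splits)
    then have "cyc_dist N p q < g" and same: "p = q \<Longrightarrow> i = j"
      using ij g \<open>p < N\<close> \<open>q < N\<close>
      by (cases "p \<le> q"; auto simp: cyc_dist_def min_less_iff_disj)+
    then have "p = q"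
      using sep[OF pq] by fastforce
    then show "p = q \<and> i = j"
      using same by simp
  qed
  moreover have "?h ` (A \<times> {0..<g}) \<subseteq> {0..<N}"
    using g by auto
  ultimately have "card (A \<times> {0..<g}) \<le> card {0..<N}"
    by (intro card_inj_on_le) auto
  then show ?thesis
    using g by (simp add: less_eq_div_iff_mult_less_eq card_cartesian_product)
qed

text \<open>Color 1 takes at most \<open>N div 3\<close> residues and each of the other \<open>k - 1\<close> colors at most
  \<open>N div 5\<close>.\<close>

lemma cyclic_coloring_counting_bound:
  assumes f: "cyclic_coloring N k f" and N: "5 \<le> N"
  shows "N \<le> N div 3 + (k - 1) * (N div 5)"
proof -
  let ?A = "\<lambda>i. {p \<in> {0..<N}. f p = i}"
  have "0 < k"
  proof -
    have "f 0 \<in> {1..k}" using f N by (auto simp: cyclic_coloring_def)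
    then show ?thesis by simp
  qed
  have class_le: "card (?A i) \<le> N div gap i" for i
    using f N by (intro card_separated_le) (auto simp: gap_def cyclic_coloring_def)
  have "{0..<N} = (\<Union>i\<in>{1..k}. ?A i)"
    using f by (auto simp: cyclic_coloring_def)
  then have "N = card (\<Union>i\<in>{1..k}. ?A i)"
    by (metis card_atLeastLessThan diff_zero)
  also have "\<dots> \<le> (\<Sum>i\<in>{1..k}. card (?A i))"
    by (rule card_UN_le) simp
  also have "\<dots> \<le> (\<Sum>i\<in>{1..k}. N div gap i)"
    by (intro sum_mono class_le)
  also have "{1..k} = insert 1 {2..k}"
    using \<open>0 < k\<close> by auto
  also have "(\<Sum>i\<in>insert 1 {2..k}. N div gap i) = N div 3 + (k - 1) * (N div 5)"
    by (simp add: gap_def)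
  finally show ?thesis .
qed

section \<open>Colorings from words\<close>

text \<open>Stated recursively, so that the condition can be checked by rewriting on concrete words and
  propagates through concatenation from the right.\<close>

fun well_spaced :: "nat list \<Rightarrow> bool" where
  "well_spaced [] \<longleftrightarrow> True"
| "well_spaced (x # xs) \<longleftrightarrow> x \<notin> set (take (gap x - 1) xs) \<and> well_spaced xs"

lemma well_spaced_nth:
  assumes "well_spaced xs" "i < j" "j < length xs" "xs ! i = xs ! j"
  shows "gap (xs ! i) \<le> j - i"
  using assms
proof (induction xs arbitrary: i j)
  case Nil
  then show ?case by simp
next
  case (Cons x xs)
  from \<open>i < j\<close> obtain j' where j: "j = Suc j'" by (cases j) auto
  show ?case
  proof (cases i)
    case 0
    have "\<not> j' < gap x - 1"
    proof
      assume "j' < gap x - 1"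
      then have "take (gap x - 1) xs ! j' \<in> set (take (gap x - 1) xs)"
        using Cons.prems j by (intro nth_mem) simp
      then show False using Cons.prems j 0 \<open>j' < gap x - 1\<close> by simp
    qed
    then show ?thesis using 0 j by simp
  next
    case (Suc i')
    then show ?thesis using Cons.IH[of i' j'] Cons.prems j by simp
  qed
qed

text \<open>Writing the word twice turns distances around the cycle into distances within a word.\<close>

lemma cyclic_coloring_of_word:
  assumes w: "well_spaced (w @ w)" and set: "set w \<subseteq> {1..k}" and N: "length w = N"
  shows "cyclic_coloring N k ((!) w)"
proof -
  have ordered: "gap (w ! p) \<le> cyc_dist (length w) p q"
    if "p < q" "q < length w" "w ! p = w ! q" for p q
  proof -
    have "gap (w ! p) \<le> q - p"
      using well_spaced_nth[OF w, of p q] that by (simp add: nth_append)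
    moreover have "gap (w ! p) \<le> p + length w - q"
      using well_spaced_nth[OF w, of q "p + length w"] that by (simp add: nth_append)
    ultimately show ?thesis using that by (simp add: cyc_dist_def)
  qed
  have "gap (w ! p) \<le> cyc_dist (length w) p q"
    if "p < length w" "q < length w" "p \<noteq> q" "w ! p = w ! q" for p q
    using ordered[of p q] ordered[of q p] that
    by (cases "p < q") (simp_all add: cyc_dist_commute[of _ p q])
  moreover have "(!) w \<in> {0..<length w} \<rightarrow> {1..k}"
    by (intro Pi_I subsetD[OF set]) simp
  ultimately show ?thesis
    by (simp add: cyclic_coloring_def flip: N)
qed

definition block :: "bool \<Rightarrow> nat list" where
  "block b = (if b then [1, 2, 3, 1, 4, 5] else [1, 2, 3, 4, 5])"

text \<open>An inserted 1 only moves the other colors further apart, and in \<open>123145\<close> it is at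
  distance exactly 3 from the preceding 1 and from the 1 of the next block. Prepending a block
  to a word involves at most the first four letters of that word, all of which lie in its first
  block.\<close>

lemma well_spaced_blocks: "well_spaced (concat (map block bs))"
proof (induction bs)
  case Nil
  then show ?case by simp
next
  case (Cons b bs)
  show ?case
  proof (cases bs)
    case Nil
    then show ?thesis by (simp add: block_def gap_def)
  next
    case (Cons b' bs')
    then show ?thesis using Cons.IH by (simp add: block_def gap_def)
  qed
qed

text \<open>The number of 5s needed is determined by the residue modulo 3: none for 0, one for 2, and two
  for 1, and in the last case \<open>n \<ge> 10\<close> since 4 and 7 are excluded.\<close>

lemma eq_3_times_add_5_times:
  fixes n :: nat
  assumes "n \<ge> 3" "n \<noteq> 4" "n \<noteq> 7"
  obtains a b where "n = 3 * a + 5 * b"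
proof -
  consider "n mod 3 = 0" | "n mod 3 = 1" | "n mod 3 = 2" by linarith
  then show thesis
  proof cases
    case 1
    then have "n = 3 * (n div 3) + 5 * 0" by presburger
    then show thesis by (rule that)
  next
    case 2
    then have "n = 3 * (n div 3 - 3) + 5 * 2" using assms by presburger
    then show thesis by (rule that)
  next
    case 3
    then have "n = 3 * (n div 3 - 1) + 5 * 1" using assms by presburger
    then show thesis by (rule that)
  qed
qed

lemma ex_cyclic_coloring_5:
  assumes "n \<ge> 3" "n \<noteq> 4" "n \<noteq> 7"
  shows "\<exists>f. cyclic_coloring (2 * n) 5 f"
proof -
  obtain a b where n: "n = 3 * a + 5 * b"
    using eq_3_times_add_5_times[OF assms] .
  \<comment> \<open>The total length is \<open>6 a + 5 (2 b) = 2 n\<close>.\<close>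
  define bs where "bs = replicate a True @ replicate (2 * b) False"
  let ?w = "concat (map block bs)"
  have "well_spaced (?w @ ?w)"
    using well_spaced_blocks[of "bs @ bs"] by simp
  moreover have "set ?w \<subseteq> {1..5}"
    by (auto simp: block_def split: if_splits)
  moreover have "length ?w = 2 * n"
    by (simp add: n bs_def length_concat sum_list_replicate block_def)
  ultimately show ?thesis
    using cyclic_coloring_of_word by metis
qed

text \<open>Here every color other than 1 occurs only once, as no two residues modulo 8 are at distance 5.\<close>

lemma ex_cyclic_coloring_7: "\<exists>f. cyclic_coloring 8 7 f"
  by (rule exI, rule cyclic_coloring_of_word[of "[1, 2, 3, 1, 4, 5, 6, 7]"])
    (simp_all add: gap_def)

text \<open>The counting bound is tight here and prescribes the class sizes: four times color 1, with gaps
  3, 3, 3, 5, and each other color twice, at distance 6 or 7.\<close>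

lemma ex_cyclic_coloring_6: "\<exists>f. cyclic_coloring 14 6 f"
  by (rule exI, rule cyclic_coloring_of_word[of "[1, 2, 3, 1, 4, 5, 1, 6, 2, 1, 3, 4, 5, 6]"])
    (simp_all add: gap_def)

theorem proposition16:
  fixes S :: "nat \<Rightarrow> nat" and n :: nat
  assumes "S 1 = 1" and "\<And>i. i \<ge> 2 \<Longrightarrow> S i = 2"
    and "n \<ge> 3"
  shows "packing_total_chromatic_number S (cycle_graph n) =
           (if n = 4 then 7 else if n = 7 then 6 else 5)"
proof -
  let ?m = "if n = 4 then 7 else if n = 7 then 6 else 5"
  have "\<exists>f. cyclic_coloring (2 * n) ?m f"
    using ex_cyclic_coloring_5[OF assms(3)] ex_cyclic_coloring_6 ex_cyclic_coloring_7 by auto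
  moreover have "?m \<le> k" if "cyclic_coloring (2 * n) k f" for k f
  proof (rule ccontr)
    assume "\<not> ?m \<le> k"
    have "2 * n \<le> 2 * n div 3 + (k - 1) * (2 * n div 5)"
      using cyclic_coloring_counting_bound[OF that] assms(3) by simp
    \<comment> \<open>The bound increases with \<open>k\<close>, so it suffices to refute it for \<open>k = ?m - 1\<close>.\<close>
    also have "\<dots> \<le> 2 * n div 3 + (?m - 2) * (2 * n div 5)"
      using \<open>\<not> ?m \<le> k\<close> by (intro add_left_mono mult_right_mono) auto
    also have "\<dots> < 2 * n"
    proof -
      \<comment> \<open>Where \<open>?m = 5\<close>: the left-hand side is at most \<open>14/15\<close> of \<open>2 n\<close>.\<close>
      have "2 * n div 3 * 3 \<le> 2 * n" "2 * n div 5 * 5 \<le> 2 * n"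
        by (rule div_times_less_eq_dividend)+
      then have "2 * n div 3 + 3 * (2 * n div 5) < 2 * n"
        using assms(3) by linarith
      then show ?thesis by simp
    qed
    finally show False by simp
  qed
  ultimately show ?thesis
    unfolding packing_total_chromatic_number_def
    using ex_packing_total_coloring_iff[of S n, OF assms]
    by (intro Least_equality) blast+
qed

end
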